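(* Let $(X,\mathcal B,\mu)$ be a separable probability space. Let $P_j(n,N)$, $j=1,\dots,\ell$, be nonconstant polynomials of $n$ and $N$, taking on integer values on integers, which are essentially distinct (i.e. $P_i(n,N)-P_j(n,N)$ is not identically constant for $i\ne j$) and depend nontrivially on $n$ (i.e. no $P_i(n,N)$ is just a polynomial of $N$). If $T$ is a strongly $2\ell$-mixing invertible measure preserving transformation of $(X,\mathcal B,\mu)$, then for any bounded measurable functions $f_j$, $j=1,\dots,\ell$, on $X$, $$\lim_{N\to\infty}\frac 1N\sum_{n=1}^N\prod_{j=1}^\ell T^{P_j(n,N)}f_j=\prod_{j=1}^\ell\int f_j\,d\mu\quad\text{in } L^2(X,\mu).$$
   Context: For $m\in\mathbb Z$, $T^mf(x)=f(T^mx)$. $T$ is strongly $m$-mixing if for any measurable sets $\Gamma_1,\dots,\Gamma_m$, $$\lim_{|k_i-k_j|\to\infty,\ \forall i\ne j}\mu\Big(\bigcap_{i=1}^mT^{-k_i}\Gamma_i\Big)=\lim_{l_1,\dots,l_{m-1}\to\infty}\mu(\Gamma_1\cap T^{-l_1}\Gamma_2\cap\dots\cap T^{-(l_1+\cdots+l_{m-1})}\Gamma_m)=\prod_{i=1}^m\mu(\Gamma_i).$$ *)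

theory Defs
  imports "HOL-Probability.Probability" "HOL-Computational_Algebra.Polynomial"
begin

section \<open>Separable probability spaces and invertible measure preserving maps\<close>

text \<open>
  Separability of the measure algebra: the measurable sets with the pseudometric
  \<open>d(A, B) = \<mu>(A \<triangle> B)\<close> have a countable dense subset (equivalently, the space
  \<open>L\<^sup>2(\<mu>)\<close> is separable).  Every countably generated probability space satisfies this.
\<close>
definition separable_prob_space :: "'a measure \<Rightarrow> bool" where
  "separable_prob_space M \<longleftrightarrow> prob_space M \<and>
     (\<exists>D. countable D \<and> D \<subseteq> sets M \<and>
        (\<forall>A\<in>sets M. \<forall>e>0. \<exists>B\<in>D. measure M ((A - B) \<union> (B - A)) < e))"

definition invertible_measure_preserving :: "'a measure \<Rightarrow> ('a \<Rightarrow> 'a) \<Rightarrow> bool" where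
  "invertible_measure_preserving M T \<longleftrightarrow>
     bij_betw T (space M) (space M) \<and>
     T \<in> measurable M M \<and>
     inv_into (space M) T \<in> measurable M M \<and>
     (\<forall>A\<in>sets M. emeasure M (T -` A \<inter> space M) = emeasure M A)"

text \<open>The integer power \<open>T\<^sup>k\<close>; its values are meaningful on \<open>space M\<close> only.\<close>
definition iter :: "'a measure \<Rightarrow> ('a \<Rightarrow> 'a) \<Rightarrow> int \<Rightarrow> 'a \<Rightarrow> 'a" where
  "iter M T k = (if k \<ge> 0 then T ^^ nat k else inv_into (space M) T ^^ nat (- k))"


section \<open>Strong \<open>m\<close>-mixing\<close>

text \<open>
  The filter on index families \<open>(k\<^sub>1, \<dots>, k\<^sub>m)\<close> of integers for
  ``\<open>\<bar>k\<^sub>i - k\<^sub>j\<bar> \<rightarrow> \<infinity>\<close> for all \<open>i \<noteq> j\<close>''; only the values of \<open>k\<close>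
  on \<open>{1..m}\<close> matter.
\<close>
definition gaps_at_top :: "nat \<Rightarrow> (nat \<Rightarrow> int) filter" where
  "gaps_at_top m =
     (INF K. principal {k. \<forall>i\<in>{1..m}. \<forall>j\<in>{1..m}. i \<noteq> j \<longrightarrow> K \<le> \<bar>k i - k j\<bar>})"

definition strongly_mixing :: "nat \<Rightarrow> 'a measure \<Rightarrow> ('a \<Rightarrow> 'a) \<Rightarrow> bool" where
  "strongly_mixing m M T \<longleftrightarrow>
     (\<forall>\<Gamma>. (\<forall>i\<in>{1..m}. \<Gamma> i \<in> sets M) \<longrightarrow>
        ((\<lambda>k. measure M (\<Inter>i\<in>{1..m}. iter M T (k i) -` \<Gamma> i \<inter> space M))
           \<longlongrightarrow> (\<Prod>i\<in>{1..m}. measure M (\<Gamma> i))) (gaps_at_top m))"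

lemma eventually_gaps_at_top:
  "eventually P (gaps_at_top m) \<longleftrightarrow>
     (\<exists>K. \<forall>k. (\<forall>i\<in>{1..m}. \<forall>j\<in>{1..m}. i \<noteq> j \<longrightarrow> K \<le> \<bar>k i - k j\<bar>) \<longrightarrow> P k)"
proof -
  let ?A = "\<lambda>K. {k. \<forall>i\<in>{1..m}. \<forall>j\<in>{1..m}. i \<noteq> j \<longrightarrow> K \<le> \<bar>k i - k j :: int\<bar>}"
  have "\<exists>x\<in>UNIV. principal (?A x) \<le> principal (?A a) \<and> principal (?A x) \<le> principal (?A b)"
    for a b by (rule bexI[of _ "max a b"]) auto
  then have "eventually P (gaps_at_top m) \<longleftrightarrow> (\<exists>K\<in>UNIV. eventually P (principal (?A K)))"
    unfolding gaps_at_top_def by (intro eventually_INF_base) auto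
  then show ?thesis by (auto simp: eventually_principal)
qed

text \<open>
  Strong mixing is often stated with \<open>k\<^sub>1 = 0\<close> and \<open>k\<^sub>i = l\<^sub>1 + \<dots> + l\<^sub>i\<^sub>-\<^sub>1\<close>, where
  \<open>l\<^sub>1, \<dots>, l\<^sub>m\<^sub>-\<^sub>1 \<rightarrow> \<infinity>\<close>.  That limit is a consequence of the definition above.
\<close>
lemma strongly_mixing_increments:
  assumes "strongly_mixing m M T" and "\<And>i. i \<in> {1..m} \<Longrightarrow> \<Gamma> i \<in> sets M" and "e > 0"
  shows "\<exists>L. \<forall>l :: nat \<Rightarrow> int. (\<forall>i\<in>{1..<m}. L \<le> l i) \<longrightarrow>
     \<bar>measure M (\<Inter>i\<in>{1..m}. iter M T (\<Sum>j\<in>{1..<i}. l j) -` \<Gamma> i \<inter> space M)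
       - (\<Prod>i\<in>{1..m}. measure M (\<Gamma> i))\<bar> < e"
proof -
  let ?\<mu> = "\<lambda>k. measure M (\<Inter>i\<in>{1..m}. iter M T (k i) -` \<Gamma> i \<inter> space M)"
  have "(?\<mu> \<longlongrightarrow> (\<Prod>i\<in>{1..m}. measure M (\<Gamma> i))) (gaps_at_top m)"
    using assms unfolding strongly_mixing_def by blast
  then have "eventually (\<lambda>k. dist (?\<mu> k) (\<Prod>i\<in>{1..m}. measure M (\<Gamma> i)) < e) (gaps_at_top m)"
    using \<open>e > 0\<close> by (rule tendstoD)
  then obtain K where K: "\<And>k. (\<And>i j. i \<in> {1..m} \<Longrightarrow> j \<in> {1..m} \<Longrightarrow> i \<noteq> j \<Longrightarrow> K \<le> \<bar>k i - k j\<bar>)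
      \<Longrightarrow> dist (?\<mu> k) (\<Prod>i\<in>{1..m}. measure M (\<Gamma> i)) < e"
    unfolding eventually_gaps_at_top by blast
  show ?thesis
  proof (intro exI[of _ "max K 0"] allI impI)
    fix l :: "nat \<Rightarrow> int" assume l: "\<forall>i\<in>{1..<m}. max K 0 \<le> l i"
    let ?k = "\<lambda>i. \<Sum>j\<in>{1..<i}. l j"
    have *: "K \<le> ?k j - ?k i" if ij: "1 \<le> i" "i < j" "j \<le> m" for i j
    proof -
      have "?k j = ?k i + sum l {i..<j}"
        using sum.atLeastLessThan_concat[of 1 i j l] ij by simp
      moreover have "l i \<le> sum l {i..<j}"
        by (rule member_le_sum) (use l ij in auto)
      moreover have "K \<le> l i" using l ij by auto
      ultimately show ?thesis by linarith
    qed
    have "K \<le> \<bar>?k i - ?k j\<bar>" if ij: "i \<in> {1..m}" "j \<in> {1..m}" "i \<noteq> j" for i j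
    proof (cases "i < j")
      case True
      then show ?thesis using *[of i j] ij by auto
    next
      case False
      then show ?thesis using *[of j i] ij by auto
    qed
    from K[of ?k, OF this]
    show "\<bar>?\<mu> ?k - (\<Prod>i\<in>{1..m}. measure M (\<Gamma> i))\<bar> < e"
      by (simp add: dist_real_def)
  qed
qed


section \<open>Polynomials in \<open>n\<close> and \<open>N\<close>\<close>

text \<open>
  A polynomial \<open>P(n, N)\<close> is an element of \<open>\<real>[N][n]\<close>: a polynomial in \<open>n\<close> whose coefficients
  are polynomials in \<open>N\<close>.  So \<open>[:q:]\<close> is a polynomial \<open>q\<close> of \<open>N\<close> alone, and \<open>[:[:c:]:]\<close>
  is the constant \<open>c\<close>.
\<close>
definition eval2 :: "real poly poly \<Rightarrow> int \<Rightarrow> int \<Rightarrow> real" where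
  "eval2 P n N = poly (poly P [:of_int n:]) (of_int N)"

definition integer_valued :: "real poly poly \<Rightarrow> bool" where
  "integer_valued P \<longleftrightarrow> (\<forall>n N. eval2 P n N \<in> \<int>)"

text \<open>The floor is the identity on the values of an integer valued polynomial.\<close>
definition int_eval2 :: "real poly poly \<Rightarrow> int \<Rightarrow> int \<Rightarrow> int" where
  "int_eval2 P n N = \<lfloor>eval2 P n N\<rfloor>"


section \<open>Convergence in \<open>L\<^sup>2\<close>\<close>

definition square_integrable :: "'a measure \<Rightarrow> ('a \<Rightarrow> complex) \<Rightarrow> bool" where
  "square_integrable M f \<longleftrightarrow> f \<in> borel_measurable M \<and> integrable M (\<lambda>x. (cmod (f x))\<^sup>2)"

definition L2_norm :: "'a measure \<Rightarrow> ('a \<Rightarrow> complex) \<Rightarrow> real" where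
  "L2_norm M f = sqrt (LINT x|M. (cmod (f x))\<^sup>2)"

definition tendsto_L2 :: "'a measure \<Rightarrow> (nat \<Rightarrow> 'a \<Rightarrow> complex) \<Rightarrow> ('a \<Rightarrow> complex) \<Rightarrow> bool" where
  "tendsto_L2 M u g \<longleftrightarrow>
     (\<forall>N. square_integrable M (u N)) \<and> square_integrable M g \<and>
     (\<lambda>N. L2_norm M (\<lambda>x. u N x - g x)) \<longlonglongrightarrow> 0"

end

theory Submission
  imports Defs
begin

text \<open>
  Write \<open>c = \<Prod>\<^sub>j \<integral> f\<^sub>j d\<mu>\<close> and \<open>a\<^sub>N\<^sub>,\<^sub>n = \<Prod>\<^sub>j f\<^sub>j \<circ> T\<^bsup>P\<^sub>j(n, N)\<^esup>\<close>.  The squared \<open>L\<^sup>2\<close> norm of the average of the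
  functions \<open>a\<^sub>N\<^sub>,\<^sub>n - c\<close> is the average, over the \<open>N\<^sup>2\<close> pairs \<open>(n, m)\<close>, of the covariances
  \<open>\<integral> (a\<^sub>N\<^sub>,\<^sub>n - c) \<cdot> cnj (a\<^sub>N\<^sub>,\<^sub>m - c) d\<mu>\<close>.  Each covariance involves \<open>2l\<close> powers of \<open>T\<close>, with the
  exponents \<open>P\<^sub>1(n, N), \<dots>, P\<^sub>l(n, N), P\<^sub>1(m, N), \<dots>, P\<^sub>l(m, N)\<close>.  Hence strong \<open>2l\<close>-mixing makes
  it small as soon as these exponents are pairwise far apart
  (\<open>separated_covariance_tendsto_zero\<close>), and all covariances are bounded.  It is enough that
  the pairs \<open>(n, m)\<close> for which two exponents are within a fixed distance \<open>K\<close> form a set of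
  size \<open>O(N)\<close>, for then they contribute \<open>O(1/N)\<close> to the average
  (\<open>L2_norm_average_tendsto_zero\<close>).

  This is a count of polynomial roots (\<open>linear_card_unseparated_pairs\<close>).  Since \<open>P\<^sub>i\<close> depends
  on \<open>n\<close>, for large \<open>N\<close> the polynomial \<open>P\<^sub>i(\<cdot>, N)\<close> is nonconstant of degree bounded
  independently of \<open>N\<close>, so \<open>P\<^sub>i(n, N)\<close> is close to a prescribed value, such as \<open>P\<^sub>j(m, N)\<close>, for
  boundedly many \<open>n\<close> only.  The same holds for \<open>P\<^sub>i - P\<^sub>j\<close> near \<open>0\<close> if this difference depends on
  \<open>n\<close>; if it is a nonconstant polynomial of \<open>N\<close> alone, it leaves every bounded interval as
  \<open>N\<close> grows.

  Mixing is given for sets.  It extends to bounded functions one factor at a time, by uniform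
  approximation with simple functions (\<open>strongly_mixing_functions\<close>).
\<close>

section \<open>Bounded measurable functions\<close>

definition bounded_measurable :: "'a measure \<Rightarrow> ('a \<Rightarrow> complex) set" where
  "bounded_measurable M = {f \<in> borel_measurable M. bounded (f ` space M)}"

lemma bounded_measurable_iff:
  "f \<in> bounded_measurable M \<longleftrightarrow>
    f \<in> borel_measurable M \<and> (\<exists>B. \<forall>x\<in>space M. cmod (f x) \<le> B)"
  by (auto simp: bounded_measurable_def bounded_iff)

lemma bounded_measurable_indicator:
  "A \<in> sets M \<Longrightarrow> (indicator A :: 'a \<Rightarrow> complex) \<in> bounded_measurable M"
  unfolding bounded_measurable_iff by (auto intro!: exI[of _ 1] simp: indicator_def)

lemma bounded_measurable_const: "(\<lambda>_. c) \<in> bounded_measurable M"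
  unfolding bounded_measurable_iff by auto

lemma bounded_measurable_cnj:
  "f \<in> bounded_measurable M \<Longrightarrow> (\<lambda>x. cnj (f x)) \<in> bounded_measurable M"
  unfolding bounded_measurable_iff
  by (auto intro!: borel_measurable_continuous_on[of cnj] continuous_intros)

lemma bounded_measurable_mult:
  assumes "f \<in> bounded_measurable M" "g \<in> bounded_measurable M"
  shows "(\<lambda>x. f x * g x) \<in> bounded_measurable M"
proof -
  obtain A B where "\<forall>x\<in>space M. cmod (f x) \<le> A" "\<forall>x\<in>space M. cmod (g x) \<le> B"
    using assms by (auto simp: bounded_measurable_iff)
  then have "\<forall>x\<in>space M. cmod (f x * g x) \<le> A * B"
    by (auto simp: norm_mult intro!: mult_mono intro: order_trans[OF norm_ge_zero])
  then show ?thesis using assms by (auto simp: bounded_measurable_iff)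
qed

lemma bounded_measurable_add:
  assumes "f \<in> bounded_measurable M" "g \<in> bounded_measurable M"
  shows "(\<lambda>x. f x + g x) \<in> bounded_measurable M"
proof -
  obtain A B where "\<forall>x\<in>space M. cmod (f x) \<le> A" "\<forall>x\<in>space M. cmod (g x) \<le> B"
    using assms by (auto simp: bounded_measurable_iff)
  then have "\<forall>x\<in>space M. cmod (f x + g x) \<le> A + B"
    by (auto intro!: norm_triangle_le add_mono)
  then show ?thesis using assms by (auto simp: bounded_measurable_iff)
qed

lemma bounded_measurable_diff:
  assumes "f \<in> bounded_measurable M" "g \<in> bounded_measurable M"
  shows "(\<lambda>x. f x - g x) \<in> bounded_measurable M"
  using bounded_measurable_add[OF assms(1)
      bounded_measurable_mult[OF bounded_measurable_const[of "-1"] assms(2)]]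
  by simp

lemma bounded_measurable_sum:
  assumes "\<And>i. i \<in> I \<Longrightarrow> f i \<in> bounded_measurable M"
  shows "(\<lambda>x. \<Sum>i\<in>I. f i x) \<in> bounded_measurable M"
  using assms
  by (induction I rule: infinite_finite_induct)
     (auto intro!: bounded_measurable_add bounded_measurable_const)

lemma bounded_measurable_prod:
  assumes "\<And>i. i \<in> I \<Longrightarrow> f i \<in> bounded_measurable M"
  shows "(\<lambda>x. \<Prod>i\<in>I. f i x) \<in> bounded_measurable M"
  using assms
  by (induction I rule: infinite_finite_induct)
     (auto intro!: bounded_measurable_mult bounded_measurable_const)

lemma bounded_measurable_compose:
  assumes "f \<in> bounded_measurable M" "\<phi> \<in> measurable M M"
  shows "(\<lambda>x. f (\<phi> x)) \<in> bounded_measurable M"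
  using assms measurable_space[OF assms(2)]
  by (auto simp: bounded_measurable_iff intro: measurable_compose)

lemma (in prob_space) bounded_measurable_integrable:
  "f \<in> bounded_measurable M \<Longrightarrow> integrable M f"
  by (auto simp: bounded_measurable_iff intro!: integrable_const_bound)

lemma (in prob_space) bounded_measurable_square_integrable:
  assumes g: "g \<in> bounded_measurable M"
  shows "square_integrable M g"
proof -
  have "integrable M (\<lambda>x. g x * cnj (g x))"
    by (intro bounded_measurable_integrable bounded_measurable_mult bounded_measurable_cnj g)
  then have "integrable M (\<lambda>x. complex_of_real ((cmod (g x))\<^sup>2))"
    by (simp add: complex_norm_square del: of_real_power)
  then have "integrable M (\<lambda>x. Re (complex_of_real ((cmod (g x))\<^sup>2)))" by (rule integrable_Re)
  then have "integrable M (\<lambda>x. (cmod (g x))\<^sup>2)" by simp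
  then show ?thesis using g by (simp add: square_integrable_def bounded_measurable_def)
qed

lemma (in prob_space) norm_integral_le_bound:
  assumes "f \<in> bounded_measurable M" "\<And>x. x \<in> space M \<Longrightarrow> cmod (f x) \<le> B"
  shows "cmod (LINT x|M. f x) \<le> B"
proof -
  have "cmod (LINT x|M. f x) \<le> (LINT x|M. cmod (f x))" by (rule integral_norm_bound)
  also have "\<dots> \<le> (LINT x|M. B)"
    using assms bounded_measurable_integrable[OF assms(1)] by (intro integral_mono) auto
  also have "\<dots> = B" by (simp add: prob_space)
  finally show ?thesis .
qed

text \<open>
  Round the real and the imaginary part of \<open>f\<close> down to a multiple of a small number.  Because
  \<open>f\<close> is bounded, the result takes finitely many values, and it is constant on measurable sets.
  The approximation is uniform, so an error in one factor survives multiplication by bounded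
  factors.
\<close>
lemma uniform_simple_approximation:
  assumes f: "f \<in> bounded_measurable M" and "e > 0"
  obtains J A where "finite J" "\<And>c. A c \<in> sets M"
    "\<And>x. x \<in> space M \<Longrightarrow> cmod (f x - (\<Sum>c\<in>J. c * indicator (A c) x)) \<le> e"
proof -
  have [measurable]: "f \<in> borel_measurable M" using f by (auto simp: bounded_measurable_iff)
  obtain B where B: "\<And>x. x \<in> space M \<Longrightarrow> cmod (f x) \<le> B"
    using f by (auto simp: bounded_measurable_iff)
  \<comment> \<open>Each of the two parts is rounded to the grid of width \<open>1 / n = e / 2\<close>.\<close>
  define n where "n = 2 / e"
  have n: "n > 0" using \<open>e > 0\<close> by (simp add: n_def)
  define g where "g x = Complex (\<lfloor>n * Re (f x)\<rfloor> / n) (\<lfloor>n * Im (f x)\<rfloor> / n)" for x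
  have g_eq: "g x = of_real (\<lfloor>n * Re (f x)\<rfloor> / n) + \<i> * of_real (\<lfloor>n * Im (f x)\<rfloor> / n)" for x
    by (simp add: g_def complex_eq_iff)
  have [measurable]: "g \<in> borel_measurable M" unfolding g_eq by measurable
  define R where "R = {- \<lceil>n * B\<rceil> - 1..\<lceil>n * B\<rceil>}"
  have in_R: "\<lfloor>n * t\<rfloor> \<in> R" if "\<bar>t\<bar> \<le> B" for t :: real
  proof -
    have "\<bar>n * t\<bar> \<le> n * B" using that n by (simp add: abs_mult)
    then show ?thesis unfolding R_def by (simp add: le_floor_iff floor_le_iff abs_le_iff) linarith
  qed
  have "g ` space M \<subseteq> (\<lambda>(a, b). Complex (of_int a / n) (of_int b / n)) ` (R \<times> R)"
  proof
    fix y assume "y \<in> g ` space M"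
    then obtain x where x: "x \<in> space M" "y = g x" by auto
    have "\<bar>Re (f x)\<bar> \<le> B" "\<bar>Im (f x)\<bar> \<le> B"
      using B[OF x(1)] abs_Re_le_cmod[of "f x"] abs_Im_le_cmod[of "f x"] by auto
    then show "y \<in> (\<lambda>(a, b). Complex (of_int a / n) (of_int b / n)) ` (R \<times> R)"
      using in_R x by (force simp: g_def)
  qed
  then have fin: "finite (g ` space M)" by (rule finite_subset) (simp add: R_def)
  show ?thesis
  proof (rule that[of "g ` space M" "\<lambda>c. g -` {c} \<inter> space M"])
    show "finite (g ` space M)" by fact
    show "g -` {c} \<inter> space M \<in> sets M" for c by measurable
    fix x assume x: "x \<in> space M"
    have "(\<Sum>c\<in>g ` space M. c * indicator (g -` {c} \<inter> space M) x) =
        (\<Sum>c\<in>g ` space M. if c = g x then c else 0)"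
      by (intro sum.cong) (auto simp: indicator_def x)
    also have "\<dots> = g x" using fin x by simp
    finally have *: "(\<Sum>c\<in>g ` space M. c * indicator (g -` {c} \<inter> space M) x) = g x" .
    have **: "\<bar>t - \<lfloor>n * t\<rfloor> / n\<bar> \<le> 1 / n" for t
    proof -
      have "t - \<lfloor>n * t\<rfloor> / n = (n * t - \<lfloor>n * t\<rfloor>) / n" using n by (simp add: field_simps)
      also have "\<bar>\<dots>\<bar> = \<bar>n * t - \<lfloor>n * t\<rfloor>\<bar> / n" using n by (simp add: abs_div)
      also have "\<dots> \<le> 1 / n" using n by (intro divide_right_mono) (auto, linarith)
      finally show ?thesis .
    qed
    have "cmod (f x - g x) \<le> \<bar>Re (f x - g x)\<bar> + \<bar>Im (f x - g x)\<bar>" by (rule cmod_le)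
    also have "\<dots> \<le> 1 / n + 1 / n" unfolding g_def using ** by (intro add_mono) simp_all
    also have "\<dots> = e" using \<open>e > 0\<close> by (simp add: n_def)
    finally show "cmod (f x - (\<Sum>c\<in>g ` space M. c * indicator (g -` {c} \<inter> space M) x)) \<le> e"
      using * by simp
  qed
qed

section \<open>Strong mixing for bounded functions\<close>

text \<open>
  Both sides are linear in \<open>f\<close> and change by at most a constant times \<open>sup \<bar>f - g\<bar>\<close>, uniformly
  in \<open>k\<close>, when \<open>f\<close> is replaced by \<open>g\<close>.  So the set of \<open>f\<close> for which the limit holds is closed under
  linear combinations and uniform limits.  The weight \<open>R k\<close> stands for the product of the
  factors that are kept fixed.
\<close>
lemma (in prob_space) tendsto_integral_from_indicators:
  fixes R :: "'i \<Rightarrow> 'a \<Rightarrow> complex" and c :: complex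
  assumes \<phi>: "\<And>k. \<phi> k \<in> measurable M M"
    and R: "\<And>k. R k \<in> bounded_measurable M"
    and R_le: "\<And>k x. x \<in> space M \<Longrightarrow> cmod (R k x) \<le> C"
    and ind: "\<And>A. A \<in> sets M \<Longrightarrow>
      ((\<lambda>k. LINT x|M. indicator A (\<phi> k x) * R k x) \<longlongrightarrow> (LINT x|M. indicator A x) * c) F"
    and f: "f \<in> bounded_measurable M"
  shows "((\<lambda>k. LINT x|M. f (\<phi> k x) * R k x) \<longlongrightarrow> (LINT x|M. f x) * c) F"
proof (rule tendstoI)
  fix e :: real assume "e > 0"
  have int: "integrable M (\<lambda>x. h (\<phi> k x) * R k x)" if "h \<in> bounded_measurable M" for h k
    by (intro bounded_measurable_integrable bounded_measurable_mult
        bounded_measurable_compose[OF that] \<phi> R)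
  \<comment> \<open>An approximation within \<open>d\<close> costs \<open>d * \<bar>C\<bar>\<close> on the left and \<open>d * cmod c\<close> on the right; the
    limit for the approximating function is reached up to a further \<open>d\<close>.\<close>
  define D where "D = \<bar>C\<bar> + 1 + cmod c"
  define d where "d = e / D"
  have "D > 0" unfolding D_def using norm_ge_zero[of c] by linarith
  then have d: "d > 0" "d * D = e" using \<open>e > 0\<close> by (auto simp: d_def)
  then have d_sum: "d * \<bar>C\<bar> + d + d * cmod c = e" by (simp add: D_def distrib_left)
  obtain J A where J: "finite J" and A: "\<And>c. A c \<in> sets M"
    and approx: "\<And>x. x \<in> space M \<Longrightarrow> cmod (f x - (\<Sum>c\<in>J. c * indicator (A c) x)) \<le> d"
    using uniform_simple_approximation[OF f d(1)] by metis
  define g :: "'a \<Rightarrow> complex" where "g x = (\<Sum>c\<in>J. c * indicator (A c) x)" for x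
  have g: "g \<in> bounded_measurable M"
    unfolding g_def[abs_def]
    by (intro bounded_measurable_sum bounded_measurable_mult bounded_measurable_const
        bounded_measurable_indicator A)
  have int_ind: "integrable M (indicator (A c) :: 'a \<Rightarrow> complex)" for c
    by (intro bounded_measurable_integrable bounded_measurable_indicator A)
  have "(LINT x|M. g (\<phi> k x) * R k x) =
      (\<Sum>c\<in>J. c * (LINT x|M. indicator (A c) (\<phi> k x) * R k x))" for k
    unfolding g_def sum_distrib_right mult.assoc
    using int[OF bounded_measurable_indicator[OF A]] by (subst Bochner_Integration.integral_sum) auto
  moreover have "(LINT x|M. g x) * c = (\<Sum>b\<in>J. b * ((LINT x|M. indicator (A b) x) * c))"
    unfolding g_def using int_ind
    by (subst Bochner_Integration.integral_sum) (auto simp: sum_distrib_right mult.assoc)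
  moreover have "((\<lambda>k. \<Sum>c\<in>J. c * (LINT x|M. indicator (A c) (\<phi> k x) * R k x)) \<longlongrightarrow>
      (\<Sum>b\<in>J. b * ((LINT x|M. indicator (A b) x) * c))) F"
    by (intro tendsto_intros ind A)
  ultimately have "((\<lambda>k. LINT x|M. g (\<phi> k x) * R k x) \<longlongrightarrow> (LINT x|M. g x) * c) F" by simp
  then have "\<forall>\<^sub>F k in F. dist (LINT x|M. g (\<phi> k x) * R k x) ((LINT x|M. g x) * c) < d"
    using d(1) by (rule tendstoD)
  then show "\<forall>\<^sub>F k in F. dist (LINT x|M. f (\<phi> k x) * R k x) ((LINT x|M. f x) * c) < e"
  proof eventually_elim
    fix k assume *: "dist (LINT x|M. g (\<phi> k x) * R k x) ((LINT x|M. g x) * c) < d"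
    have fg: "(\<lambda>x. f x - g x) \<in> bounded_measurable M" by (rule bounded_measurable_diff[OF f g])
    have "(LINT x|M. f (\<phi> k x) * R k x) - (LINT x|M. g (\<phi> k x) * R k x) =
        (LINT x|M. (f (\<phi> k x) - g (\<phi> k x)) * R k x)"
      using int[OF f] int[OF g] by (simp add: left_diff_distrib)
    also have "cmod \<dots> \<le> d * \<bar>C\<bar>"
    proof (rule norm_integral_le_bound)
      show "(\<lambda>x. (f (\<phi> k x) - g (\<phi> k x)) * R k x) \<in> bounded_measurable M"
        by (intro bounded_measurable_mult R bounded_measurable_compose[OF fg \<phi>])
      fix x assume x: "x \<in> space M"
      then have "\<phi> k x \<in> space M" using measurable_space[OF \<phi>] by auto
      then show "cmod ((f (\<phi> k x) - g (\<phi> k x)) * R k x) \<le> d * \<bar>C\<bar>"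
        unfolding norm_mult using approx R_le[OF x, of k] d(1)
        by (intro mult_mono) (auto simp: g_def)
    qed
    finally have 1: "cmod ((LINT x|M. f (\<phi> k x) * R k x) - (LINT x|M. g (\<phi> k x) * R k x)) \<le> d * \<bar>C\<bar>" .
    have "(LINT x|M. f x) * c - (LINT x|M. g x) * c = (LINT x|M. f x - g x) * c"
      using bounded_measurable_integrable f g by (simp add: left_diff_distrib)
    also have "cmod \<dots> \<le> d * cmod c"
      unfolding norm_mult
      by (intro mult_right_mono norm_integral_le_bound[OF fg]) (auto simp: g_def approx)
    finally have 2: "cmod ((LINT x|M. f x) * c - (LINT x|M. g x) * c) \<le> d * cmod c" .
    have "cmod ((p - q) + (q - r) + (r - s)) \<le> cmod (p - q) + cmod (q - r) + cmod (s - r)" for p q r s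
      by (metis norm_minus_commute norm_triangle_ineq norm_triangle_le add_mono order_refl)
    from this[of "LINT x|M. f (\<phi> k x) * R k x" "LINT x|M. g (\<phi> k x) * R k x"
        "(LINT x|M. g x) * c" "(LINT x|M. f x) * c"]
    show "dist (LINT x|M. f (\<phi> k x) * R k x) ((LINT x|M. f x) * c) < e"
      using 1 2 * d_sum by (simp add: dist_norm)
  qed
qed

lemma (in prob_space) integral_complex_indicator:
  assumes "A \<in> sets M"
  shows "(LINT x|M. indicator A x) = complex_of_real (measure M A)"
proof -
  have "(LINT x|M. indicator A x) = (LINT x|M. complex_of_real (indicator A x))"
    by (intro Bochner_Integration.integral_cong) (auto simp: indicator_def)
  also have "\<dots> = complex_of_real (measure M A)"
    using assms by (simp only: integral_complex_of_real) simp
  finally show ?thesis .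
qed

lemma measurable_funpow_self: "S \<in> measurable M M \<Longrightarrow> S ^^ n \<in> measurable M M"
  by (induction n) (auto intro: measurable_comp)

lemma iter_measurable:
  "invertible_measure_preserving M T \<Longrightarrow> iter M T k \<in> measurable M M"
  unfolding iter_def invertible_measure_preserving_def by (auto intro: measurable_funpow_self)

lemma bounded_measurable_prod_iter:
  assumes "invertible_measure_preserving M T" "\<And>i. i \<in> I \<Longrightarrow> F i \<in> bounded_measurable M"
  shows "(\<lambda>x. \<Prod>i\<in>I. F i (iter M T (k i) x)) \<in> bounded_measurable M"
  by (rule bounded_measurable_prod,
      rule bounded_measurable_compose[OF assms(2) iter_measurable[OF assms(1)]])

lemma uniform_bound_prod_iter:
  fixes F :: "'i \<Rightarrow> 'a \<Rightarrow> complex"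
  assumes "finite I" "\<And>i. i \<in> I \<Longrightarrow> F i \<in> bounded_measurable M"
    and T: "invertible_measure_preserving M T"
  obtains C where
    "\<And>k x. x \<in> space M \<Longrightarrow> cmod (\<Prod>i\<in>I. F i (iter M T (k i) x)) \<le> C"
proof -
  have "\<forall>i\<in>I. \<exists>B. \<forall>x\<in>space M. cmod (F i x) \<le> B"
    using assms by (auto simp: bounded_measurable_iff)
  then obtain B where B: "\<And>i x. i \<in> I \<Longrightarrow> x \<in> space M \<Longrightarrow> cmod (F i x) \<le> B i" by metis
  show ?thesis
  proof (rule that)
    fix k :: "'i \<Rightarrow> int" and x assume "x \<in> space M"
    then have "\<And>i. iter M T (k i) x \<in> space M"
      using measurable_space[OF iter_measurable[OF T]] by auto
    then show "cmod (\<Prod>i\<in>I. F i (iter M T (k i) x)) \<le> (\<Prod>i\<in>I. B i)"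
      by (auto simp: prod_norm[symmetric] intro!: prod_mono B)
  qed
qed

text \<open>
  If all \<open>F i\<close> are indicators, the integral is the measure of an intersection, and this is the
  mixing hypothesis; \<open>m \<ge> 1\<close> keeps that intersection inside the space.  The indicators are then
  replaced by general functions one after the other: the induction is on the set of indices
  where \<open>F\<close> need not be an indicator.
\<close>
lemma (in prob_space) strongly_mixing_functions:
  assumes T: "invertible_measure_preserving M T" and mix: "strongly_mixing m M T" and "m \<ge> 1"
    and F: "\<And>i. i \<in> {1..m} \<Longrightarrow> F i \<in> bounded_measurable M"
  shows "((\<lambda>k. LINT x|M. (\<Prod>i=1..m. F i (iter M T (k i) x))) \<longlongrightarrow>
    (\<Prod>i=1..m. LINT x|M. F i x)) (gaps_at_top m)"
proof -
  have "finite S \<Longrightarrow> S \<subseteq> {1..m} \<Longrightarrow> (\<And>i. i \<in> {1..m} \<Longrightarrow> F i \<in> bounded_measurable M) \<Longrightarrow>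
      (\<And>i. i \<in> {1..m} - S \<Longrightarrow> \<exists>A\<in>sets M. F i = indicator A) \<Longrightarrow>
      ((\<lambda>k. LINT x|M. (\<Prod>i=1..m. F i (iter M T (k i) x))) \<longlongrightarrow>
        (\<Prod>i=1..m. LINT x|M. F i x)) (gaps_at_top m)" for S
  proof (induction S arbitrary: F rule: finite_induct)
    case empty
    then have "\<forall>i\<in>{1..m}. \<exists>A. A \<in> sets M \<and> F i = indicator A" by blast
    then obtain A where A: "\<And>i. i \<in> {1..m} \<Longrightarrow> A i \<in> sets M"
      "\<And>i. i \<in> {1..m} \<Longrightarrow> F i = indicator (A i)" by metis
    define E where "E k = (\<Inter>i\<in>{1..m}. iter M T (k i) -` A i \<inter> space M)" for k
    have E: "E k \<in> sets M" for k
      unfolding E_def using \<open>m \<ge> 1\<close> A(1) measurable_sets[OF iter_measurable[OF T]]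
      by (intro sets.finite_INT) auto
    have "(LINT x|M. (\<Prod>i=1..m. F i (iter M T (k i) x))) = of_real (measure M (E k))" for k
    proof -
      have "(\<Prod>i=1..m. F i (iter M T (k i) x)) = indicator (E k) x" if "x \<in> space M" for x
        using that A(2) by (auto simp: E_def indicator_def prod_zero_iff split: if_splits)
      then have "(LINT x|M. (\<Prod>i=1..m. F i (iter M T (k i) x))) = (LINT x|M. indicator (E k) x)"
        by (intro Bochner_Integration.integral_cong) auto
      also have "\<dots> = of_real (measure M (E k))"
        by (rule integral_complex_indicator[OF E])
      finally show ?thesis .
    qed
    moreover have "(\<Prod>i=1..m. LINT x|M. F i x) = of_real (\<Prod>i=1..m. measure M (A i))"
      unfolding of_real_prod using A by (intro prod.cong) (auto simp: integral_complex_indicator)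
    moreover have "((\<lambda>k. measure M (E k)) \<longlongrightarrow> (\<Prod>i=1..m. measure M (A i))) (gaps_at_top m)"
      using mix A(1) unfolding strongly_mixing_def E_def by blast
    ultimately show ?case by (simp add: tendsto_of_real del: of_real_prod)
  next
    case (insert r S)
    define R where "R k x = (\<Prod>i\<in>{1..m} - {r}. F i (iter M T (k i) x))" for k x
    define c where "c = (\<Prod>i\<in>{1..m} - {r}. LINT x|M. F i x)"
    have r: "r \<in> {1..m}" using insert by auto
    have R: "R k \<in> bounded_measurable M" for k
      unfolding R_def[abs_def] by (rule bounded_measurable_prod_iter[OF T]) (auto intro: insert.prems(2))
    obtain C where C: "\<And>k x. x \<in> space M \<Longrightarrow> cmod (R k x) \<le> C"
      unfolding R_def
      by (rule uniform_bound_prod_iter[of "{1..m} - {r}" F, OF _ _ T]) (auto intro: insert.prems(2))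
    have split_prod: "(\<Prod>i=1..m. (F(r := h)) i (iter M T (k i) x)) = h (iter M T (k r) x) * R k x"
      "(\<Prod>i=1..m. LINT x|M. (F(r := h)) i x) = (LINT x|M. h x) * c" for h k x
      unfolding R_def c_def using r by (subst prod.remove[of _ r]; force intro!: prod.cong)+
    have "((\<lambda>k. LINT x|M. F r (iter M T (k r) x) * R k x) \<longlongrightarrow> (LINT x|M. F r x) * c) (gaps_at_top m)"
    proof (rule tendsto_integral_from_indicators[OF iter_measurable[OF T] R C])
      fix A assume A: "A \<in> sets M"
      have "((\<lambda>k. LINT x|M. (\<Prod>i=1..m. (F(r := indicator A)) i (iter M T (k i) x))) \<longlongrightarrow>
        (\<Prod>i=1..m. LINT x|M. (F(r := indicator A)) i x)) (gaps_at_top m)"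
        using insert.prems A by (intro insert.IH) (auto simp: bounded_measurable_indicator)
      then show "((\<lambda>k. LINT x|M. indicator A (iter M T (k r) x) * R k x) \<longlongrightarrow>
          (LINT x|M. indicator A x) * c) (gaps_at_top m)"
        unfolding split_prod .
    qed (use r insert.prems in auto)
    then show ?case using split_prod[of "F r"] by simp
  qed
  from this[of "{1..m}"] F show ?thesis by auto
qed

text \<open>
  The \<open>2l\<close> factors are read as two groups of \<open>l\<close>, one for each of the two functions whose
  covariance is wanted.
\<close>
lemma (in prob_space) strongly_mixing_two_blocks:
  assumes T: "invertible_measure_preserving M T" and mix: "strongly_mixing (2 * l) M T" and "l \<ge> 1"
    and g: "\<And>j. j \<in> {1..l} \<Longrightarrow> g j \<in> bounded_measurable M"
    and h: "\<And>j. j \<in> {1..l} \<Longrightarrow> h j \<in> bounded_measurable M"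
  shows "((\<lambda>k. LINT x|M. (\<Prod>j=1..l. g j (iter M T (k j) x)) *
      (\<Prod>j=1..l. h j (iter M T (k (j + l)) x))) \<longlongrightarrow>
    (\<Prod>j=1..l. LINT x|M. g j x) * (\<Prod>j=1..l. LINT x|M. h j x)) (gaps_at_top (2 * l))"
proof -
  define F where "F i = (if i \<le> l then g i else h (i - l))" for i
  have split_prod: "(\<Prod>i=1..2 * l. G i) = (\<Prod>j=1..l. G j) * (\<Prod>j=1..l. G (j + l))"
    for G :: "nat \<Rightarrow> complex"
  proof -
    have "(\<Prod>i=1..l + l. G i) = prod G {1..l} * prod G {l + 1..l + l}"
      by (rule prod.ub_add_nat) simp
    also have "prod G {l + 1..l + l} = (\<Prod>j=1..l. G (j + l))"
      using prod.shift_bounds_cl_nat_ivl[of G 1 l l] by (simp add: add.commute)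
    finally show ?thesis by (simp add: mult_2)
  qed
  have "((\<lambda>k. LINT x|M. (\<Prod>i=1..2 * l. F i (iter M T (k i) x))) \<longlongrightarrow>
      (\<Prod>i=1..2 * l. LINT x|M. F i x)) (gaps_at_top (2 * l))"
    using \<open>l \<ge> 1\<close> by (intro strongly_mixing_functions T mix) (auto simp: F_def intro!: g h)
  moreover have "(\<Prod>j=1..l. F j (iter M T (k j) x)) = (\<Prod>j=1..l. g j (iter M T (k j) x))"
    "(\<Prod>j=1..l. F (j + l) (iter M T (k (j + l)) x)) = (\<Prod>j=1..l. h j (iter M T (k (j + l)) x))"
    "(\<Prod>j=1..l. LINT x|M. F j x) = (\<Prod>j=1..l. LINT x|M. g j x)"
    "(\<Prod>j=1..l. LINT x|M. F (j + l) x) = (\<Prod>j=1..l. LINT x|M. h j x)" for k x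
    by (auto intro!: prod.cong simp: F_def)
  ultimately show ?thesis unfolding split_prod by simp
qed

text \<open>
  Multiplying out gives four terms, each of which tends to \<open>\<bar>c\<bar>\<^sup>2\<close> up to sign.  For the two terms
  with a single product, the functions of the other group are taken to be \<open>1\<close>, so that
  \<open>2l\<close>-mixing covers them along the same exponents.
\<close>
lemma (in prob_space) separated_covariance_tendsto_zero:
  assumes T: "invertible_measure_preserving M T" and mix: "strongly_mixing (2 * l) M T" and "l \<ge> 1"
    and f: "\<And>j. j \<in> {1..l} \<Longrightarrow> f j \<in> bounded_measurable M"
  defines "c \<equiv> \<Prod>j=1..l. LINT x|M. f j x"
  shows "((\<lambda>k. LINT x|M. ((\<Prod>j=1..l. f j (iter M T (k j) x)) - c) *
      cnj ((\<Prod>j=1..l. f j (iter M T (k (j + l)) x)) - c)) \<longlongrightarrow> 0) (gaps_at_top (2 * l))"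
proof -
  define a where "a k x = (\<Prod>j=1..l. f j (iter M T (k j) x))" for k x
  define b where "b k x = (\<Prod>j=1..l. cnj (f j (iter M T (k (j + l)) x)))" for k x
  have cnj_c: "(\<Prod>j=1..l. LINT x|M. cnj (f j x)) = cnj c"
    by (simp add: c_def)
  note two = strongly_mixing_two_blocks[OF T mix \<open>l \<ge> 1\<close>]
  have "((\<lambda>k. LINT x|M. a k x * b k x) \<longlongrightarrow> c * cnj c) (gaps_at_top (2 * l))"
    using two[of f "\<lambda>j x. cnj (f j x)", OF f bounded_measurable_cnj[OF f]]
    unfolding cnj_c a_def b_def c_def[symmetric] by simp
  moreover have "((\<lambda>k. LINT x|M. a k x) \<longlongrightarrow> c) (gaps_at_top (2 * l))"
    using two[of f "\<lambda>j x. 1", OF f bounded_measurable_const]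
    unfolding a_def c_def[symmetric] by (simp add: prob_space)
  moreover have "((\<lambda>k. LINT x|M. b k x) \<longlongrightarrow> cnj c) (gaps_at_top (2 * l))"
    using two[of "\<lambda>j x. 1" "\<lambda>j x. cnj (f j x)", OF bounded_measurable_const bounded_measurable_cnj[OF f]]
    unfolding cnj_c b_def by (simp add: prob_space)
  ultimately have "((\<lambda>k. (LINT x|M. a k x * b k x) - cnj c * (LINT x|M. a k x)
      - c * (LINT x|M. b k x) + c * cnj c) \<longlongrightarrow> c * cnj c - cnj c * c - c * cnj c + c * cnj c)
      (gaps_at_top (2 * l))"
    by (intro tendsto_intros)
  moreover have "(LINT x|M. a k x * b k x) - cnj c * (LINT x|M. a k x)
      - c * (LINT x|M. b k x) + c * cnj c = (LINT x|M. (a k x - c) * cnj (a (\<lambda>j. k (j + l)) x - c))" for k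
  proof -
    have a: "a k \<in> bounded_measurable M" for k
      unfolding a_def[abs_def] by (rule bounded_measurable_prod_iter[OF T f])
    have b_eq: "b k x = cnj (a (\<lambda>j. k (j + l)) x)" for x by (simp add: a_def b_def)
    then have b: "b k \<in> bounded_measurable M"
      using bounded_measurable_cnj[OF a[of "\<lambda>j. k (j + l)"]] by (simp add: b_eq[abs_def])
    have "(LINT x|M. (a k x - c) * cnj (a (\<lambda>j. k (j + l)) x - c)) =
        (LINT x|M. a k x * b k x - cnj c * a k x - c * b k x + c * cnj c)"
      unfolding b_eq by (intro Bochner_Integration.integral_cong) (auto simp: algebra_simps)
    also have "\<dots> = (LINT x|M. a k x * b k x) - cnj c * (LINT x|M. a k x)
      - c * (LINT x|M. b k x) + c * cnj c"
      using bounded_measurable_integrable[OF a[of k]] bounded_measurable_integrable[OF b]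
        bounded_measurable_integrable[OF bounded_measurable_mult[OF a[of k] b]]
      by (simp add: prob_space)
    finally show ?thesis by simp
  qed
  ultimately show ?thesis unfolding a_def by simp
qed

section \<open>Counting near coincidences of polynomial values\<close>

lemma poly_poly_const:
  "poly (poly P [:a:]) b = poly (map_poly (\<lambda>q. poly q b) P) (a :: real)"
  by (induction P) (auto simp: map_poly_pCons)

lemma eventually_poly_neq_0:
  assumes "q \<noteq> (0 :: real poly)"
  shows "\<forall>\<^sub>F N in sequentially. poly q (real N) \<noteq> 0"
proof -
  have "finite (real -` {x. poly q x = 0})"
    by (intro finite_vimageI poly_roots_finite assms inj_of_nat)
  then show ?thesis
    unfolding cofinite_eq_sequentially[symmetric] eventually_cofinite by (simp add: vimage_def)
qed

lemma int_eval2_eq_iff: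
  "integer_valued P \<Longrightarrow> int_eval2 P n N = v \<longleftrightarrow> eval2 P n N = of_int v"
  unfolding integer_valued_def int_eval2_def by (metis floor_of_int Ints_cases)

lemma integer_valued_diff: "integer_valued P \<Longrightarrow> integer_valued Q \<Longrightarrow> integer_valued (P - Q)"
  by (auto simp: integer_valued_def eval2_def)

lemma int_eval2_diff:
  assumes "integer_valued P" "integer_valued Q"
  shows "int_eval2 (P - Q) n N = int_eval2 P n N - int_eval2 Q n N"
proof -
  have "eval2 P n N = of_int (int_eval2 P n N)" "eval2 Q n N = of_int (int_eval2 Q n N)"
    using assms int_eval2_eq_iff by blast+
  then have "eval2 (P - Q) n N = of_int (int_eval2 P n N - int_eval2 Q n N)"
    by (simp add: eval2_def)
  then show ?thesis by (simp add: int_eval2_eq_iff[OF integer_valued_diff[OF assms]])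
qed

text \<open>
  For large \<open>N\<close> the leading coefficient of \<open>D\<close>, a polynomial of \<open>N\<close>, does not vanish.  Then
  \<open>D(\<cdot>, N)\<close> has the degree of \<open>D\<close>, and it takes each of the at most \<open>2 K + 1\<close> integer values near
  \<open>v\<close> at most \<open>degree D\<close> times.  It matters that the bound is uniform in \<open>v\<close>, since \<open>v\<close> will be an
  exponent that depends on \<open>m\<close> and \<open>N\<close>.
\<close>
lemma bounded_card_near_value:
  assumes D: "integer_valued D" and dep: "\<And>q. D \<noteq> [:q:]"
  shows "\<exists>C. \<forall>\<^sub>F N in sequentially. \<forall>v.
    card {n\<in>{1..N}. \<bar>int_eval2 D (int n) (int N) - v\<bar> < K} \<le> C"
proof -
  define d where "d = degree D"
  have d: "d > 0" unfolding d_def using dep by (metis degree_eq_zeroE gr0I)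
  then have "lead_coeff D \<noteq> 0" by (auto simp: d_def)
  then have "\<forall>\<^sub>F N in sequentially. poly (lead_coeff D) (real N) \<noteq> 0" by (rule eventually_poly_neq_0)
  then have "\<forall>\<^sub>F N in sequentially. \<forall>v.
    card {n\<in>{1..N}. \<bar>int_eval2 D (int n) (int N) - v\<bar> < K} \<le> nat (2 * K + 1) * d"
  proof eventually_elim
    fix N assume N: "poly (lead_coeff D) (real N) \<noteq> 0"
    have level: "card {n\<in>{1..N}. int_eval2 D (int n) (int N) = w} \<le> d" for w
    proof -
      define p where "p = map_poly (\<lambda>q. poly q (real N)) D - [:of_int w:]"
      have "coeff p d \<noteq> 0" using N d by (cases d) (auto simp: p_def coeff_map_poly d_def)
      then have "p \<noteq> 0" by auto
      have "degree p \<le> d"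
        unfolding p_def d_def
        by (intro degree_le) (auto simp: coeff_map_poly coeff_eq_0 coeff_pCons split: nat.split)
      have "real ` {n\<in>{1..N}. int_eval2 D (int n) (int N) = w} \<subseteq> {x. poly p x = 0}"
        using D by (auto simp: p_def int_eval2_eq_iff eval2_def poly_poly_const)
      then have "card (real ` {n\<in>{1..N}. int_eval2 D (int n) (int N) = w}) \<le> card {x. poly p x = 0}"
        by (intro card_mono poly_roots_finite \<open>p \<noteq> 0\<close>)
      also have "\<dots> \<le> degree p" by (rule card_poly_roots_bound[OF \<open>p \<noteq> 0\<close>])
      finally show ?thesis using \<open>degree p \<le> d\<close> by (simp add: card_image)
    qed
    show "\<forall>v. card {n\<in>{1..N}. \<bar>int_eval2 D (int n) (int N) - v\<bar> < K} \<le> nat (2 * K + 1) * d"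
    proof
      fix v
      have "{n\<in>{1..N}. \<bar>int_eval2 D (int n) (int N) - v\<bar> < K} \<subseteq>
          (\<Union>w\<in>{v - K..v + K}. {n\<in>{1..N}. int_eval2 D (int n) (int N) = w})"
        by auto
      then have "card {n\<in>{1..N}. \<bar>int_eval2 D (int n) (int N) - v\<bar> < K} \<le>
          card (\<Union>w\<in>{v - K..v + K}. {n\<in>{1..N}. int_eval2 D (int n) (int N) = w})"
        by (intro card_mono) auto
      also have "\<dots> \<le> (\<Sum>w\<in>{v - K..v + K}. card {n\<in>{1..N}. int_eval2 D (int n) (int N) = w})"
        by (rule card_UN_le) simp
      also have "\<dots> \<le> (\<Sum>w\<in>{v - K..v + K}. d)" by (intro sum_mono level)
      also have "\<dots> = nat (2 * K + 1) * d" by simp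
      finally show "card {n\<in>{1..N}. \<bar>int_eval2 D (int n) (int N) - v\<bar> < K} \<le> nat (2 * K + 1) * d" .
    qed
  qed
  then show ?thesis by blast
qed

text \<open>
  Here \<open>D\<close> will be \<open>P i - P j\<close>, which can be a polynomial of \<open>N\<close> alone.  In that case the set is
  empty for large \<open>N\<close>, because each of the finitely many integers near \<open>0\<close> is a value of \<open>D\<close> for
  finitely many \<open>N\<close> only.
\<close>
lemma bounded_card_near_zero:
  assumes D: "integer_valued D" and nonconst: "\<And>c. D \<noteq> [:[:c:]:]"
  shows "\<exists>C. \<forall>\<^sub>F N in sequentially.
    card {n\<in>{1..N}. \<bar>int_eval2 D (int n) (int N)\<bar> < K} \<le> C"
proof (cases "\<exists>q. D = [:q:]")
  case False
  then obtain C where "\<forall>\<^sub>F N in sequentially. \<forall>v.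
    card {n\<in>{1..N}. \<bar>int_eval2 D (int n) (int N) - v\<bar> < K} \<le> C"
    using bounded_card_near_value[OF D] by blast
  then have "\<forall>\<^sub>F N in sequentially. card {n\<in>{1..N}. \<bar>int_eval2 D (int n) (int N)\<bar> < K} \<le> C"
  proof eventually_elim
    case (elim N)
    show ?case using spec[OF elim, of 0] by simp
  qed
  then show ?thesis by blast
next
  case True
  then obtain q where q: "D = [:q:]" by blast
  have "\<forall>\<^sub>F N in sequentially. \<forall>w\<in>{-K..K}. poly (q - [:of_int w:]) (real N) \<noteq> 0"
    using nonconst q by (intro eventually_ball_finite ballI eventually_poly_neq_0) auto
  then have "\<forall>\<^sub>F N in sequentially. card {n\<in>{1..N}. \<bar>int_eval2 D (int n) (int N)\<bar> < K} \<le> 0"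
  proof eventually_elim
    fix N assume N: "\<forall>w\<in>{-K..K}. poly (q - [:of_int w:]) (real N) \<noteq> 0"
    have "eval2 D (int n) (int N) = of_int (int_eval2 D (int n) (int N))" for n
      using int_eval2_eq_iff[OF D] by blast
    then have "poly q (real N) = of_int (int_eval2 D (int n) (int N))" for n
      by (simp add: eval2_def q)
    then have "poly (q - [:of_int (int_eval2 D (int n) (int N)):]) (real N) = 0" for n by simp
    then have "int_eval2 D (int n) (int N) \<notin> {-K..K}" for n using N by blast
    then have "\<not> \<bar>int_eval2 D (int n) (int N)\<bar> < K" for n
      by (metis abs_less_iff atLeastAtMost_iff less_imp_le minus_less_iff)
    then have "{n\<in>{1..N}. \<bar>int_eval2 D (int n) (int N)\<bar> < K} = {}" by blast
    then show "card {n\<in>{1..N}. \<bar>int_eval2 D (int n) (int N)\<bar> < K} \<le> 0" by simp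
  qed
  then show ?thesis by blast
qed

lemma card_pairs_le_fibres:
  assumes "finite A" "finite B" "\<And>b. b \<in> B \<Longrightarrow> card {a\<in>A. Q a b} \<le> C"
  shows "card {(a, b) \<in> A \<times> B. Q a b} \<le> C * card B"
    and "card {(b, a) \<in> B \<times> A. Q a b} \<le> C * card B"
proof -
  have *: "{(b, a) \<in> B \<times> A. Q a b} = Sigma B (\<lambda>b. {a\<in>A. Q a b})" by auto
  have "card {(b, a) \<in> B \<times> A. Q a b} = (\<Sum>b\<in>B. card {a\<in>A. Q a b})"
    unfolding * using assms by simp
  also have "\<dots> \<le> C * card B" using sum_mono[of B "\<lambda>b. card {a\<in>A. Q a b}" "\<lambda>_. C"] assms
    by (simp add: mult.commute)
  finally show "card {(b, a) \<in> B \<times> A. Q a b} \<le> C * card B" .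
  moreover have "{(a, b) \<in> A \<times> B. Q a b} = prod.swap ` {(b, a) \<in> B \<times> A. Q a b}" by auto
  ultimately show "card {(a, b) \<in> A \<times> B. Q a b} \<le> C * card B"
    by (simp add: card_image)
qed

text \<open>
  The exponents \<open>P\<^sub>1(n, N), \<dots>, P\<^sub>l(n, N), P\<^sub>1(m, N), \<dots>, P\<^sub>l(m, N)\<close> as one family indexed by
  \<open>1, \<dots>, 2l\<close>, the form in which \<open>gaps_at_top\<close> measures their separation.
\<close>
definition paired_exponent :: "nat \<Rightarrow> (nat \<Rightarrow> real poly poly) \<Rightarrow> nat \<Rightarrow> nat \<Rightarrow> nat \<Rightarrow> nat \<Rightarrow> int" where
  "paired_exponent l P N n m i =
    (if i \<le> l then int_eval2 (P i) (int n) (int N) else int_eval2 (P (i - l)) (int m) (int N))"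

text \<open>
  It suffices to bound, for each pair \<open>i \<noteq> j\<close> of indices, the number of \<open>(n, m)\<close> for which these
  two exponents are close.  If exponent \<open>i\<close> is computed from \<open>n\<close>, fix \<open>m\<close> and count \<open>n\<close>: exponent
  \<open>j\<close> is then either a fixed number or another polynomial at the same \<open>n\<close>.  Otherwise fix \<open>n\<close> and
  count \<open>m\<close>.  In all cases there are boundedly many solutions for each fixed value.
\<close>
lemma linear_card_unseparated_pairs:
  assumes iv: "\<And>j. j \<in> {1..l} \<Longrightarrow> integer_valued (P j)"
    and distinct: "\<And>i j c. i \<in> {1..l} \<Longrightarrow> j \<in> {1..l} \<Longrightarrow> i \<noteq> j \<Longrightarrow> P i - P j \<noteq> [:[:c:]:]"
    and dep: "\<And>j q. j \<in> {1..l} \<Longrightarrow> P j \<noteq> [:q:]"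
  shows "\<exists>C. \<forall>\<^sub>F N in sequentially. card {(n, m) \<in> {1..N} \<times> {1..N}.
    \<exists>i\<in>{1..2 * l}. \<exists>j\<in>{1..2 * l}. i \<noteq> j \<and>
      \<bar>paired_exponent l P N n m i - paired_exponent l P N n m j\<bar> < K} \<le> C * N"
proof -
  define Bad where "Bad N = (\<lambda>(i, j). {(n, m) \<in> {1..N} \<times> {1..N}.
    \<bar>paired_exponent l P N n m i - paired_exponent l P N n m j\<bar> < K})" for N
  define I where "I = {(i, j) \<in> {1..2 * l} \<times> {1..2 * l}. i \<noteq> j}"
  have "finite I" unfolding I_def by (rule finite_subset[of _ "{1..2 * l} \<times> {1..2 * l}"]) auto
  have near: "\<exists>C. \<forall>\<^sub>F N in sequentially. \<forall>v.
      card {n\<in>{1..N}. \<bar>int_eval2 (P i) (int n) (int N) - v\<bar> < K} \<le> C" if "i \<in> {1..l}" for i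
    using bounded_card_near_value[OF iv[OF that] dep[OF that]] .
  have close: "\<exists>C. \<forall>\<^sub>F N in sequentially.
      card {n\<in>{1..N}. \<bar>int_eval2 (P i) (int n) (int N) - int_eval2 (P j) (int n) (int N)\<bar> < K} \<le> C"
    if "i \<in> {1..l}" "j \<in> {1..l}" "i \<noteq> j" for i j
    using bounded_card_near_zero[OF integer_valued_diff[OF iv iv] distinct[OF that], of K] that
    by (simp add: int_eval2_diff iv)
  have "\<exists>C. \<forall>\<^sub>F N in sequentially. card (Bad N p) \<le> C * N" if "p \<in> I" for p
  proof -
    obtain i j where p: "p = (i, j)" by (cases p)
    with that have ij: "i \<in> {1..2 * l}" "j \<in> {1..2 * l}" "i \<noteq> j" by (auto simp: I_def)
    show ?thesis
    proof (cases "i \<le> l")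
      case True
      have "\<exists>C. \<forall>\<^sub>F N in sequentially. \<forall>m. card {n\<in>{1..N}.
          \<bar>paired_exponent l P N n m i - paired_exponent l P N n m j\<bar> < K} \<le> C"
        using near[of i] close[of i j] True ij
        by (cases "j \<le> l") (auto simp: paired_exponent_def elim!: eventually_mono)
      then obtain C where "\<forall>\<^sub>F N in sequentially. \<forall>m. card {n\<in>{1..N}.
          \<bar>paired_exponent l P N n m i - paired_exponent l P N n m j\<bar> < K} \<le> C" by blast
      then have "\<forall>\<^sub>F N in sequentially. card (Bad N p) \<le> C * N"
      proof eventually_elim
        case (elim N)
        then show ?case unfolding Bad_def p
          using card_pairs_le_fibres(1)[of "{1..N}" "{1..N}" "\<lambda>n m. \<bar>paired_exponent l P N n m i - paired_exponent l P N n m j\<bar> < K" C]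
          by simp
      qed
      then show ?thesis by blast
    next
      case False
      have i: "i - l \<in> {1..l}" using False ij by auto
      have "\<exists>C. \<forall>\<^sub>F N in sequentially. \<forall>n. card {m\<in>{1..N}.
          \<bar>paired_exponent l P N n m i - paired_exponent l P N n m j\<bar> < K} \<le> C"
      proof (cases "j \<le> l")
        case True
        then show ?thesis using near[OF i] False by (auto simp: paired_exponent_def elim!: eventually_mono)
      next
        case j: False
        then have "j - l \<in> {1..l}" "i - l \<noteq> j - l" using ij False by auto
        then show ?thesis using close[OF i, of "j - l"] False j by (auto simp: paired_exponent_def)
      qed
      then obtain C where "\<forall>\<^sub>F N in sequentially. \<forall>n. card {m\<in>{1..N}.
          \<bar>paired_exponent l P N n m i - paired_exponent l P N n m j\<bar> < K} \<le> C" by blast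
      then have "\<forall>\<^sub>F N in sequentially. card (Bad N p) \<le> C * N"
      proof eventually_elim
        case (elim N)
        then show ?case unfolding Bad_def p
          using card_pairs_le_fibres(2)[of "{1..N}" "{1..N}" "\<lambda>m n. \<bar>paired_exponent l P N n m i - paired_exponent l P N n m j\<bar> < K" C]
          by simp
      qed
      then show ?thesis by blast
    qed
  qed
  then obtain C where C: "\<And>p. p \<in> I \<Longrightarrow> \<forall>\<^sub>F N in sequentially. card (Bad N p) \<le> C p * N" by metis
  have "\<forall>\<^sub>F N in sequentially. \<forall>p\<in>I. card (Bad N p) \<le> C p * N"
    using C \<open>finite I\<close> by (intro eventually_ball_finite) auto
  then have "\<forall>\<^sub>F N in sequentially. card {(n, m) \<in> {1..N} \<times> {1..N}.
    \<exists>i\<in>{1..2 * l}. \<exists>j\<in>{1..2 * l}. i \<noteq> j \<and>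
      \<bar>paired_exponent l P N n m i - paired_exponent l P N n m j\<bar> < K} \<le> (\<Sum>p\<in>I. C p) * N"
  proof eventually_elim
    case (elim N)
    have "{(n, m) \<in> {1..N} \<times> {1..N}. \<exists>i\<in>{1..2 * l}. \<exists>j\<in>{1..2 * l}. i \<noteq> j \<and>
      \<bar>paired_exponent l P N n m i - paired_exponent l P N n m j\<bar> < K} = (\<Union>p\<in>I. Bad N p)"
      unfolding I_def Bad_def by blast
    also have "card \<dots> \<le> (\<Sum>p\<in>I. card (Bad N p))" by (rule card_UN_le[OF \<open>finite I\<close>])
    also have "\<dots> \<le> (\<Sum>p\<in>I. C p * N)" using elim by (intro sum_mono) auto
    finally show ?case by (simp add: sum_distrib_right)
  qed
  then show ?thesis by blast
qed

section \<open>Averages of almost uncorrelated functions\<close>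

text \<open>
  The squared norm of the average is the mean of \<open>N\<^sup>2\<close> covariances.  Those below \<open>e\<close> contribute at
  most \<open>e\<close>, and the \<open>O(N)\<close> others, each at most \<open>B\<^sup>2\<close>, contribute \<open>O(1/N)\<close>.
\<close>
lemma (in prob_space) L2_norm_average_tendsto_zero:
  fixes u :: "nat \<Rightarrow> nat \<Rightarrow> 'a \<Rightarrow> complex"
  assumes u: "\<And>N n. u N n \<in> bounded_measurable M"
    and B: "\<And>N n x. x \<in> space M \<Longrightarrow> cmod (u N n x) \<le> B"
    and few: "\<And>e. e > 0 \<Longrightarrow> \<exists>C. \<forall>\<^sub>F N in sequentially.
      card {(n, m) \<in> {1..N} \<times> {1..N}. cmod (LINT x|M. u N n x * cnj (u N m x)) \<ge> e} \<le> C * N"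
  shows "(\<lambda>N. L2_norm M (\<lambda>x. (1 / of_nat N) * (\<Sum>n=1..N. u N n x))) \<longlonglongrightarrow> 0"
proof -
  define c where "c N p = (LINT x|M. u N (fst p) x * cnj (u N (snd p) x))" for N p
  define V where "V N = (LINT x|M. (cmod ((1 / of_nat N) * (\<Sum>n=1..N. u N n x)))\<^sup>2)" for N
  have c_le: "cmod (c N p) \<le> B\<^sup>2" for N p
    unfolding c_def
  proof (rule norm_integral_le_bound)
    show "(\<lambda>x. u N (fst p) x * cnj (u N (snd p) x)) \<in> bounded_measurable M"
      by (intro bounded_measurable_mult bounded_measurable_cnj u)
    fix x assume "x \<in> space M"
    then show "cmod (u N (fst p) x * cnj (u N (snd p) x)) \<le> B\<^sup>2"
      using B[of x N "fst p"] B[of x N "snd p"]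
      by (auto simp: norm_mult power2_eq_square intro!: mult_mono intro: order_trans[OF norm_ge_zero])
  qed
  have V_nonneg: "V N \<ge> 0" for N unfolding V_def by (rule integral_nonneg_AE) simp
  have expand: "of_real (V N) = (\<Sum>p\<in>{1..N} \<times> {1..N}. c N p) / (of_nat N)\<^sup>2" for N
  proof -
    have "of_real (V N) = (LINT x|M. complex_of_real ((cmod ((1 / of_nat N) * (\<Sum>n=1..N. u N n x)))\<^sup>2))"
      unfolding V_def by (simp only: integral_complex_of_real)
    also have "\<dots> = (LINT x|M. (\<Sum>p\<in>{1..N} \<times> {1..N}. u N (fst p) x * cnj (u N (snd p) x)) / (of_nat N)\<^sup>2)"
    proof (intro Bochner_Integration.integral_cong refl)
      fix x
      have "complex_of_real ((cmod ((1 / of_nat N) * (\<Sum>n=1..N. u N n x)))\<^sup>2) =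
          (\<Sum>n=1..N. u N n x) * (\<Sum>m=1..N. cnj (u N m x)) / (of_nat N)\<^sup>2"
        unfolding complex_norm_square by (simp add: power2_eq_square)
      also have "(\<Sum>n=1..N. u N n x) * (\<Sum>m=1..N. cnj (u N m x)) =
          (\<Sum>p\<in>{1..N} \<times> {1..N}. u N (fst p) x * cnj (u N (snd p) x))"
        by (simp only: sum_product sum.cartesian_product case_prod_unfold)
      finally show "complex_of_real ((cmod ((1 / of_nat N) * (\<Sum>n=1..N. u N n x)))\<^sup>2) =
          (\<Sum>p\<in>{1..N} \<times> {1..N}. u N (fst p) x * cnj (u N (snd p) x)) / (of_nat N)\<^sup>2" .
    qed
    also have "\<dots> = (\<Sum>p\<in>{1..N} \<times> {1..N}. c N p) / (of_nat N)\<^sup>2"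
      unfolding c_def
      by (subst integral_divide_zero, subst Bochner_Integration.integral_sum)
         (auto intro!: bounded_measurable_integrable bounded_measurable_mult bounded_measurable_cnj u)
    finally show ?thesis .
  qed
  have "V \<longlonglongrightarrow> 0"
  proof (rule tendstoI)
    fix e :: real assume "e > 0"
    have "{p \<in> {1..N} \<times> {1..N}. cmod (c N p) \<ge> e / 2} = {(n, m) \<in> {1..N} \<times> {1..N}.
        cmod (LINT x|M. u N n x * cnj (u N m x)) \<ge> e / 2}" for N
      by (auto simp: c_def)
    then obtain C where C: "\<forall>\<^sub>F N in sequentially.
        card {p \<in> {1..N} \<times> {1..N}. cmod (c N p) \<ge> e / 2} \<le> C * N"
      using few[of "e / 2"] \<open>e > 0\<close> by auto
    have "(\<lambda>N. real C * B\<^sup>2 * (1 / real N)) \<longlonglongrightarrow> real C * B\<^sup>2 * 0"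
      by (intro tendsto_intros lim_1_over_n)
    then have "\<forall>\<^sub>F N in sequentially. real C * B\<^sup>2 * (1 / real N) < e / 2"
      by (rule order_tendstoD) (use \<open>e > 0\<close> in simp)
    then show "\<forall>\<^sub>F N in sequentially. dist (V N) 0 < e"
      using C eventually_gt_at_top[of 0]
    proof eventually_elim
      case (elim N)
      define S where "S = {1..N} \<times> {1..N}"
      define Bad where "Bad = {p \<in> S. cmod (c N p) \<ge> e / 2}"
      have S: "finite S" "card S = N\<^sup>2" by (simp_all add: S_def power2_eq_square)
      have "V N = cmod (of_real (V N))" using V_nonneg by simp
      also have "\<dots> = cmod (\<Sum>p\<in>S. c N p) / (real N)\<^sup>2"
        unfolding expand S_def by (simp add: norm_divide norm_power)
      also have "\<dots> \<le> (\<Sum>p\<in>S. e / 2 + (if p \<in> Bad then B\<^sup>2 else 0)) / (real N)\<^sup>2"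
        using c_le[of N] \<open>e > 0\<close> by (intro divide_right_mono sum_norm_le)
          (auto simp: Bad_def intro: add_increasing)
      also have "\<dots> \<le> ((real N)\<^sup>2 * (e / 2) + real (C * N) * B\<^sup>2) / (real N)\<^sup>2"
      proof (intro divide_right_mono)
        have "(\<Sum>p\<in>S. e / 2 + (if p \<in> Bad then B\<^sup>2 else 0)) =
            (real N)\<^sup>2 * (e / 2) + real (card Bad) * B\<^sup>2"
          using S by (simp add: sum.distrib sum.If_cases Bad_def Int_def)
        also have "\<dots> \<le> (real N)\<^sup>2 * (e / 2) + real (C * N) * B\<^sup>2"
          using elim(2) unfolding Bad_def S_def
          by (intro add_left_mono mult_right_mono) (simp_all only: of_nat_le_iff zero_le_power2)
        finally show "(\<Sum>p\<in>S. e / 2 + (if p \<in> Bad then B\<^sup>2 else 0)) \<le>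
            (real N)\<^sup>2 * (e / 2) + real (C * N) * B\<^sup>2" .
      qed simp
      also have "\<dots> = e / 2 + real C * B\<^sup>2 * (1 / real N)"
        using elim(3) by (simp add: field_simps power2_eq_square)
      also have "\<dots> < e" using elim(1) by linarith
      finally show ?case using V_nonneg[of N] by simp
    qed
  qed
  then have "(\<lambda>N. sqrt (V N)) \<longlonglongrightarrow> sqrt 0" by (rule tendsto_real_sqrt)
  then show ?thesis by (simp add: V_def L2_norm_def)
qed

section \<open>The polynomial mean ergodic theorem\<close>

theorem theorem2p9:
  fixes M :: "'a measure" and T :: "'a \<Rightarrow> 'a" and l :: nat
    and P :: "nat \<Rightarrow> real poly poly" and f :: "nat \<Rightarrow> 'a \<Rightarrow> complex"
  assumes "separable_prob_space M"
    and "l \<ge> 1"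
    and integer_valued: "\<And>j. j \<in> {1..l} \<Longrightarrow> integer_valued (P j)"
    and nonconstant: "\<And>j c. j \<in> {1..l} \<Longrightarrow> P j \<noteq> [:[:c:]:]"
    and essentially_distinct:
      "\<And>i j c. i \<in> {1..l} \<Longrightarrow> j \<in> {1..l} \<Longrightarrow> i \<noteq> j \<Longrightarrow> P i - P j \<noteq> [:[:c:]:]"
    and depends_on_n: "\<And>j q. j \<in> {1..l} \<Longrightarrow> P j \<noteq> [:q:]"
    and "invertible_measure_preserving M T"
    and "strongly_mixing (2 * l) M T"
    and measurable: "\<And>j. j \<in> {1..l} \<Longrightarrow> f j \<in> borel_measurable M"
    and bounded: "\<And>j. j \<in> {1..l} \<Longrightarrow> bounded (f j ` space M)"
  shows "tendsto_L2 M
    (\<lambda>N x. (1 / of_nat N) *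
       (\<Sum>n=1..N. \<Prod>j=1..l. f j (iter M T (int_eval2 (P j) (int n) (int N)) x)))
    (\<lambda>x. \<Prod>j=1..l. LINT y|M. f j y)"
proof -
  note T = \<open>invertible_measure_preserving M T\<close>
  interpret prob_space M using assms(1) by (simp add: separable_prob_space_def)
  have f: "f j \<in> bounded_measurable M" if "j \<in> {1..l}" for j
    using measurable bounded that by (simp add: bounded_measurable_def)
  define c where "c = (\<Prod>j=1..l. LINT y|M. f j y)"
  define a where "a N n x = (\<Prod>j=1..l. f j (iter M T (int_eval2 (P j) (int n) (int N)) x))" for N n x
  have a: "a N n \<in> bounded_measurable M" for N n
    unfolding a_def[abs_def]
    by (rule bounded_measurable_prod_iter[OF T f])
  obtain C where C: "\<And>k x. x \<in> space M \<Longrightarrow> cmod (\<Prod>j=1..l. f j (iter M T (k j) x)) \<le> C"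
    by (rule uniform_bound_prod_iter[of "{1..l}" f, OF _ f T]) auto
  have "(\<lambda>N. L2_norm M (\<lambda>x. (1 / of_nat N) * (\<Sum>n=1..N. a N n x - c))) \<longlonglongrightarrow> 0"
  proof (rule L2_norm_average_tendsto_zero)
    show "(\<lambda>x. a N n x - c) \<in> bounded_measurable M" for N n
      by (intro bounded_measurable_diff a bounded_measurable_const)
    show "cmod (a N n x - c) \<le> C + cmod c" if "x \<in> space M" for N n x
      using C[OF that, of "\<lambda>j. int_eval2 (P j) (int n) (int N)"]
      by (auto simp: a_def intro: norm_triangle_le_diff)
    fix e :: real assume "e > 0"
    have "\<forall>\<^sub>F k in gaps_at_top (2 * l). dist (LINT x|M. ((\<Prod>j=1..l. f j (iter M T (k j) x)) - c) *
        cnj ((\<Prod>j=1..l. f j (iter M T (k (j + l)) x)) - c)) 0 < e"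
      using separated_covariance_tendsto_zero[OF T assms(8) \<open>l \<ge> 1\<close> f] \<open>e > 0\<close>
      unfolding c_def by (rule tendstoD)
    then obtain K where K: "\<And>k. (\<And>i j. i \<in> {1..2 * l} \<Longrightarrow> j \<in> {1..2 * l} \<Longrightarrow> i \<noteq> j \<Longrightarrow> K \<le> \<bar>k i - k j\<bar>)
       \<Longrightarrow> cmod (LINT x|M. ((\<Prod>j=1..l. f j (iter M T (k j) x)) - c) *
        cnj ((\<Prod>j=1..l. f j (iter M T (k (j + l)) x)) - c)) < e"
      unfolding eventually_gaps_at_top dist_norm diff_0_right by blast
    have covariance: "cmod (LINT x|M. (a N n x - c) * cnj (a N m x - c)) < e"
      if "\<And>i j. i \<in> {1..2 * l} \<Longrightarrow> j \<in> {1..2 * l} \<Longrightarrow> i \<noteq> j \<Longrightarrow>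
        K \<le> \<bar>paired_exponent l P N n m i - paired_exponent l P N n m j\<bar>" for N n m
    proof -
      have "(\<Prod>j=1..l. f j (iter M T (paired_exponent l P N n m j) x)) = a N n x"
        "(\<Prod>j=1..l. f j (iter M T (paired_exponent l P N n m (j + l)) x)) = a N m x" for x
        unfolding a_def by (auto intro!: prod.cong simp: paired_exponent_def)
      then show ?thesis using K[of "paired_exponent l P N n m", OF that] by simp
    qed
    obtain C' where C': "\<forall>\<^sub>F N in sequentially. card {(n, m) \<in> {1..N} \<times> {1..N}.
      \<exists>i\<in>{1..2 * l}. \<exists>j\<in>{1..2 * l}. i \<noteq> j \<and>
        \<bar>paired_exponent l P N n m i - paired_exponent l P N n m j\<bar> < K} \<le> C' * N"
      using linear_card_unseparated_pairs[of l P K, OF integer_valued essentially_distinct depends_on_n]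
      by blast
    have "\<forall>\<^sub>F N in sequentially. card {(n, m) \<in> {1..N} \<times> {1..N}.
      cmod (LINT x|M. (a N n x - c) * cnj (a N m x - c)) \<ge> e} \<le> C' * N"
      using C'
    proof eventually_elim
      case (elim N)
      have unseparated: "\<exists>i\<in>{1..2 * l}. \<exists>j\<in>{1..2 * l}. i \<noteq> j \<and>
          \<bar>paired_exponent l P N n m i - paired_exponent l P N n m j\<bar> < K"
        if "cmod (LINT x|M. (a N n x - c) * cnj (a N m x - c)) \<ge> e" for n m
        using covariance[of N n m] that by (meson not_le)
      show ?case
      proof (rule order_trans[OF card_mono elim])
        show "finite {(n, m) \<in> {1..N} \<times> {1..N}. \<exists>i\<in>{1..2 * l}. \<exists>j\<in>{1..2 * l}. i \<noteq> j \<and>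
            \<bar>paired_exponent l P N n m i - paired_exponent l P N n m j\<bar> < K}"
          by (rule finite_subset[of _ "{1..N} \<times> {1..N}"]) auto
        show "{(n, m) \<in> {1..N} \<times> {1..N}. cmod (LINT x|M. (a N n x - c) * cnj (a N m x - c)) \<ge> e} \<subseteq>
          {(n, m) \<in> {1..N} \<times> {1..N}. \<exists>i\<in>{1..2 * l}. \<exists>j\<in>{1..2 * l}. i \<noteq> j \<and>
            \<bar>paired_exponent l P N n m i - paired_exponent l P N n m j\<bar> < K}"
          using unseparated by blast
      qed
    qed
    then show "\<exists>C. \<forall>\<^sub>F N in sequentially. card {(n, m) \<in> {1..N} \<times> {1..N}.
      cmod (LINT x|M. (a N n x - c) * cnj (a N m x - c)) \<ge> e} \<le> C * N" by blast
  qed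
  \<comment> \<open>For \<open>N = 0\<close> the two functions differ: the first average is \<open>0\<close>, not \<open>- c\<close>.\<close>
  moreover have "\<forall>\<^sub>F N in sequentially. L2_norm M (\<lambda>x. (1 / of_nat N) * (\<Sum>n=1..N. a N n x - c)) =
      L2_norm M (\<lambda>x. (1 / of_nat N) * (\<Sum>n=1..N. a N n x) - c)"
    using eventually_gt_at_top[of 0]
    by eventually_elim (simp add: sum_subtractf right_diff_distrib)
  ultimately have "(\<lambda>N. L2_norm M (\<lambda>x. (1 / of_nat N) * (\<Sum>n=1..N. a N n x) - c)) \<longlonglongrightarrow> 0"
    by (rule Lim_transform_eventually)
  moreover have "square_integrable M (\<lambda>x. (1 / of_nat N) * (\<Sum>n=1..N. a N n x))" for N
    by (intro bounded_measurable_square_integrable bounded_measurable_mult bounded_measurable_const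
        bounded_measurable_sum a)
  moreover have "square_integrable M (\<lambda>x. c)"
    by (intro bounded_measurable_square_integrable bounded_measurable_const)
  ultimately show ?thesis unfolding tendsto_L2_def a_def c_def by blast
qed

end
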